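(* Consider the hard-thresholding estimator $\hat\theta_H$ with $\eta_n\to0$ and $n^{1/2}\eta_n\to\infty$. Let $\theta_n\in\mathbb{R}$ be such that $\theta_n/\eta_n\to\zeta$ for some $\zeta\in\mathbb{R}\cup\{-\infty,\infty\}$ and $n^{1/2}\theta_n\to\nu$ for some $\nu\in\mathbb{R}\cup\{-\infty,\infty\}$. [In case $\zeta\ne0$ the convergence of $n^{1/2}\theta_n$ already follows from that of $\theta_n/\eta_n$, and then $\nu=\mathrm{sign}(\zeta)\infty$.] 1. If $|\zeta|<1$, then $F_{H,n,\theta_n}$ approaches pointmass at $-\nu$: in case $|\nu|<\infty$, $F_{H,n,\theta_n}$ converges weakly to pointmass at $-\nu$; in case $|\nu|=\infty$, the total mass of $F_{H,n,\theta_n}$ escapes to $-\nu$, in the sense that $F_{H,n,\theta_n}(x)\to0$ for every $x\in\mathbb{R}$ if $-\nu=\infty$, and $F_{H,n,\theta_n}(x)\to1$ for every $x\in\mathbb{R}$ if $-\nu=-\infty$. 2. If $|\zeta|=1$ and $n^{1/2}(\eta_n-\zeta\theta_n)\to r$ for some $r\in\mathbb{R}\cup\{-\infty,\infty\}$, then $F_{H,n,\theta_n}(x)$ converges to $$\Phi(r)\,\boldsymbol{1}(\zeta=1)+\int_{-\infty}^{x}\phi(u)\,\boldsymbol{1}(\zeta u>r)\,du$$ for every $x\in\mathbb{R}$. This limit corresponds to pointmass at $-\nu=\mathrm{sign}(-\zeta)\infty$ if $r=\infty$, and otherwise represents a convex combination of pointmass at $-\nu=\mathrm{sign}(-\zeta)\infty$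 and an absolutely continuous distribution whose density is $u\mapsto(1-\Phi(r))^{-1}\phi(u)\,\boldsymbol{1}(\zeta u>r)$, with weights $\Phi(r)$ and $1-\Phi(r)$, respectively. [The weight of the absolutely continuous component equals one in case $r=-\infty$; in this case, convergence is in fact in total variation distance.] 3. If $1<|\zeta|\le\infty$, then $F_{H,n,\theta_n}$ converges weakly to $\Phi$. [In fact, convergence is in total variation distance.]
   Context: For each $n\ge1$ and $\theta\in\mathbb{R}$, $P_{n,\theta}$ is the probability measure under which $y_1,\dots,y_n$ are independent and each $N(\theta,1)$-distributed; $\bar y=n^{-1}\sum_{t=1}^n y_t$. $(\eta_n)$ is a sequence of positive real numbers, and $\hat\theta_H=\bar y\,\boldsymbol{1}(|\bar y|>\eta_n)$, where $\boldsymbol{1}(\cdot)$ is the indicator function. $F_{H,n,\theta}$ denotes the distribution (and its cdf) of $n^{1/2}(\hat\theta_H-\theta)$ under $P_{n,\theta}$. $\Phi$ and $\phi$ are the standard normal cdf and density, $\Phi(-\infty)=0$, $\Phi(\infty)=1$. $\mathrm{sign}(x)=-1,0,1$ for $x<0$, $x=0$, $x>0$ (with $\mathrm{sign}(\pm\infty)=\pm1$). *)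

theory Defs
  imports "HOL-Probability.Probability"
begin

definition sample_mean :: "(nat \<Rightarrow> 'a \<Rightarrow> real) \<Rightarrow> nat \<Rightarrow> 'a \<Rightarrow> real" where
  "sample_mean y n \<omega> = (\<Sum>t = 1..n. y t \<omega>) / real n"

definition hard_threshold_estimator ::
    "(nat \<Rightarrow> real) \<Rightarrow> (nat \<Rightarrow> 'a \<Rightarrow> real) \<Rightarrow> nat \<Rightarrow> 'a \<Rightarrow> real" where
  "hard_threshold_estimator \<eta> y n \<omega> =
     sample_mean y n \<omega> * of_bool (\<bar>sample_mean y n \<omega>\<bar> > \<eta> n)"

text \<open>The distribution, as a Borel measure, of the centred and scaled estimator; its cdf is
  obtained by applying \<^const>\<open>cdf\<close>.\<close>

definition F_H ::
    "(nat \<Rightarrow> real \<Rightarrow> 'a measure) \<Rightarrow> (nat \<Rightarrow> 'a \<Rightarrow> real) \<Rightarrow> (nat \<Rightarrow> real) \<Rightarrow> nat \<Rightarrow> real \<Rightarrow> real measure" where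
  "F_H P y \<eta> n \<theta> =
     distr (P n \<theta>) borel (\<lambda>\<omega>. sqrt (real n) * (hard_threshold_estimator \<eta> y n \<omega> - \<theta>))"

definition Phi :: "ereal \<Rightarrow> real" where
  "Phi x = (if x = \<infinity> then 1 else if x = - \<infinity> then 0
            else cdf std_normal_distribution (real_of_ereal x))"

text \<open>Total variation distance between probability measures on the same \<open>\<sigma>\<close>-algebra, normalised
  to take values in the unit interval.\<close>

definition tv_dist :: "'a measure \<Rightarrow> 'a measure \<Rightarrow> real" where
  "tv_dist M N = (SUP A \<in> sets M. \<bar>measure M A - measure N A\<bar>)"

definition limit_cdf :: "real \<Rightarrow> ereal \<Rightarrow> real \<Rightarrow> real" where
  "limit_cdf z r x = Phi r * of_bool (z = 1) +
     (LBINT u:{..x}. std_normal_density u * of_bool (ereal (z * u) > r))"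

text \<open>The absolutely continuous component. The factor \<open>1 / (1 - Phi r)\<close> is only meaningful for
  \<open>r \<noteq> \<infinity>\<close>.\<close>

definition ac_part :: "real \<Rightarrow> ereal \<Rightarrow> real measure" where
  "ac_part z r = density lborel
     (\<lambda>u. ennreal (1 / (1 - Phi r) * std_normal_density u * of_bool (ereal (z * u) > r)))"

text \<open>The pointmass at an extended real number is the Dirac measure on the extended real line. This
  is its distribution function, restricted to real arguments.\<close>

definition pointmass_cdf :: "ereal \<Rightarrow> real \<Rightarrow> real" where
  "pointmass_cdf a x = measure (return borel a) {..ereal x}"

end

(* With a = sqrt n * theta_n and b = sqrt n * eta_n, the normalised sample mean U has the standard
   normal distribution, and the scaled estimator is U itself off the event |U + a| <= b and the
   constant -a on it. This event is -(b + a) <= U <= b - a, so the limits of b - a and b + a in the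
   extended reals decide for almost every value of U whether it eventually lies in the event.
   Dominated convergence then gives the limit of the cdf, and the probability of the event bounds
   the total variation distance to the standard normal distribution. *)

theory Submission
  imports Defs
begin

section \<open>Convergence of the measures of events\<close>

text \<open>Dominated convergence for indicators: they are eventually constant almost everywhere,
  and the dominating constant 1 is integrable because the measure is finite.\<close>

lemma (in finite_measure) tendsto_measure_AE_eventually:
  fixes C :: "nat \<Rightarrow> 'a set"
  assumes [measurable]: "\<And>n. C n \<in> sets M" "S \<in> sets M"
    and AE: "AE x in M. \<forall>\<^sub>F n in sequentially. x \<in> C n \<longleftrightarrow> x \<in> S"
  shows "(\<lambda>n. measure M (C n)) \<longlonglongrightarrow> measure M S"
proof -
  have "(\<lambda>n. \<integral>x. indicator (C n) x \<partial>M :: real) \<longlonglongrightarrow> (\<integral>x. indicator S x \<partial>M)"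
  proof (rule integral_dominated_convergence[where w="\<lambda>_. 1"])
    show "AE x in M. (\<lambda>n. indicator (C n) x :: real) \<longlonglongrightarrow> indicator S x"
      using AE
    proof eventually_elim
      case (elim x)
      then show ?case
        by (intro tendsto_eventually) (auto elim!: eventually_mono simp: indicator_def)
    qed
  qed auto
  then show ?thesis
    by simp
qed

section \<open>Reduction to a map of one standard normal variable\<close>

interpretation std_normal: real_distribution std_normal_distribution
  by (rule real_dist_normal_dist)

text \<open>The value \<open>- a\<close> is what a zero estimate becomes after centring and scaling.
  The boundary case also goes to \<open>- a\<close>, since the estimator keeps the mean only
  strictly above the threshold.\<close>

definition hard_threshold_map :: "real \<Rightarrow> real \<Rightarrow> real \<Rightarrow> real" where
  "hard_threshold_map a b u = (if \<bar>u + a\<bar> \<le> b then - a else u)"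

definition thresholded :: "real \<Rightarrow> real \<Rightarrow> real set" where
  "thresholded a b = {u. \<bar>u + a\<bar> \<le> b}"

lemma measurable_hard_threshold_map [measurable]: "hard_threshold_map a b \<in> borel_measurable borel"
  unfolding hard_threshold_map_def by measurable

lemma sets_thresholded [measurable]: "thresholded a b \<in> sets borel"
  unfolding thresholded_def by measurable

lemma AE_std_normal_neq: "AE u in std_normal_distribution. ereal u \<noteq> r"
proof -
  have "AE u in lborel. ereal u \<noteq> r"
    \<comment> \<open>For infinite \<open>r\<close> this excludes the point 0, which does no harm:
      no real equals \<open>r\<close> then.\<close>
    using AE_lborel_singleton[of "real_of_ereal r"] by eventually_elim auto
  then show ?thesis
    by (subst AE_density) (auto elim: eventually_mono)
qed

text \<open>The estimator depends on the data only through the sample mean, hence only through its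
  normalised version, which is standard normal.\<close>

lemma F_H_eq_distr_hard_threshold_map:
  fixes P :: "nat \<Rightarrow> real \<Rightarrow> 'a measure"
  assumes prob: "prob_space (P n \<tau>)" and n: "n \<ge> 1"
    and indep: "prob_space.indep_vars (P n \<tau>) (\<lambda>_. borel) y {1..n}"
    and normal: "\<And>t. t \<in> {1..n} \<Longrightarrow>
      distributed (P n \<tau>) lborel (y t) (\<lambda>x. ennreal (normal_density \<tau> 1 x))"
  shows "F_H P y \<eta> n \<tau> = distr std_normal_distribution borel
    (hard_threshold_map (sqrt n * \<tau>) (sqrt n * \<eta> n))"
proof -
  interpret prob_space "P n \<tau>" by fact
  \<comment> \<open>The normalised mean is written as an affine image of the sum, the form that
    \<open>normal_density_affine\<close> expects.\<close>
  define U where "U \<omega> = - (sqrt n * \<tau>) + 1 / sqrt n * (\<Sum>t\<in>{1..n}. y t \<omega>)" for \<omega>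
  have "distributed (P n \<tau>) lborel (\<lambda>\<omega>. \<Sum>t\<in>{1..n}. y t \<omega>)
      (normal_density (\<Sum>t\<in>{1..n}. \<tau>) (sqrt (\<Sum>t\<in>{1..n}. 1\<^sup>2)))"
    using n by (intro sum_indep_normal indep normal) auto
  then have "distributed (P n \<tau>) lborel U
      (normal_density (- (sqrt n * \<tau>) + 1 / sqrt n * (\<Sum>t\<in>{1..n}. \<tau>))
        (\<bar>1 / sqrt n\<bar> * sqrt (\<Sum>t\<in>{1..n}. 1\<^sup>2)))"
    unfolding U_def using n by (intro normal_density_affine) auto
  moreover have "- (sqrt n * \<tau>) + 1 / sqrt n * (\<Sum>t\<in>{1..n}. \<tau>) = 0"
    using n by (simp add: field_simps)
  moreover have "\<bar>1 / sqrt n\<bar> * sqrt (\<Sum>t\<in>{1..n}. 1\<^sup>2) = 1"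
    using n by simp
  ultimately have U: "distributed (P n \<tau>) lborel U std_normal_density"
    by simp
  have [measurable]: "U \<in> borel_measurable (P n \<tau>)"
    using distributed_measurable[OF U] by simp
  \<comment> \<open>\<open>distributed\<close> gives the law on \<open>lborel\<close>, whereas
    \<open>F_H\<close> uses \<open>borel\<close>; \<open>distr\<close> depends only on their common
    \<sigma>-algebra.\<close>
  have distr_U: "distr (P n \<tau>) borel U = std_normal_distribution"
    using distributed_distr_eq_density[OF U] distr_cong[OF refl sets_lborel refl] by metis
  have mean: "sqrt n * sample_mean y n \<omega> = U \<omega> + sqrt n * \<tau>" for \<omega>
    using n by (simp add: U_def sample_mean_def field_simps)
  have abs_mean: "\<bar>sample_mean y n \<omega>\<bar> > \<eta> n \<longleftrightarrow> \<not> \<bar>U \<omega> + sqrt n * \<tau>\<bar> \<le> sqrt n * \<eta> n" for \<omega>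
  proof -
    have "\<bar>U \<omega> + sqrt n * \<tau>\<bar> = sqrt n * \<bar>sample_mean y n \<omega>\<bar>"
      by (simp flip: mean add: abs_mult)
    then show ?thesis using n by (simp add: not_le)
  qed
  have "sqrt (real n) * (hard_threshold_estimator \<eta> y n \<omega> - \<tau>)
      = hard_threshold_map (sqrt n * \<tau>) (sqrt n * \<eta> n) (U \<omega>)" for \<omega>
    using mean[of \<omega>]
    by (simp add: hard_threshold_estimator_def hard_threshold_map_def abs_mean right_diff_distrib)
  then have "F_H P y \<eta> n \<tau> = distr (P n \<tau>) borel
      (hard_threshold_map (sqrt n * \<tau>) (sqrt n * \<eta> n) \<circ> U)"
    unfolding F_H_def by (simp add: comp_def)
  also have "\<dots> = distr (distr (P n \<tau>) borel U) borel
      (hard_threshold_map (sqrt n * \<tau>) (sqrt n * \<eta> n))"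
    by (subst distr_distr) auto
  finally show ?thesis
    by (simp only: distr_U)
qed

lemma vimage_hard_threshold_map:
  "hard_threshold_map a b -` A = (A - thresholded a b) \<union> (if - a \<in> A then thresholded a b else {})"
  by (auto simp: hard_threshold_map_def thresholded_def split: if_splits)

text \<open>The preimage of \<open>A\<close> splits into two disjoint pieces; the second carries the
  mass that is moved to \<open>- a\<close>.\<close>

lemma measure_distr_hard_threshold_map:
  assumes [measurable]: "A \<in> sets borel"
  shows "measure (distr std_normal_distribution borel (hard_threshold_map a b)) A =
    measure std_normal_distribution (A - thresholded a b) +
    measure std_normal_distribution (thresholded a b) * of_bool (- a \<in> A)"
proof -
  have "measure (distr std_normal_distribution borel (hard_threshold_map a b)) A =
      measure std_normal_distribution (hard_threshold_map a b -` A)"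
    by (subst measure_distr) auto
  also have "\<dots> = measure std_normal_distribution (A - thresholded a b) +
      measure std_normal_distribution (if - a \<in> A then thresholded a b else {})"
    unfolding vimage_hard_threshold_map by (rule std_normal.finite_measure_Union) auto
  finally show ?thesis
    by simp
qed

section \<open>Total variation distance to the standard normal law\<close>

text \<open>On a set \<open>A\<close> the two measures differ by the mass moved into
  \<open>A\<close> minus the mass of \<open>A\<close> that is thresholded. Both lie between 0 and
  the mass of the event, so the difference is bounded by that mass.\<close>

lemma tv_dist_hard_threshold_map:
  shows tv_dist_hard_threshold_map_nonneg:
      "0 \<le> tv_dist (distr std_normal_distribution borel (hard_threshold_map a b)) std_normal_distribution"
      (is "0 \<le> tv_dist ?D ?N")
    and tv_dist_hard_threshold_map_le:
      "tv_dist (distr std_normal_distribution borel (hard_threshold_map a b)) std_normal_distribution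
        \<le> measure std_normal_distribution (thresholded a b)"
proof -
  have le: "\<bar>measure ?D A - measure ?N A\<bar> \<le> measure ?N (thresholded a b)" if "A \<in> sets ?D" for A
  proof -
    have [measurable]: "A \<in> sets borel"
      using that by simp
    have "measure ?N A = measure ?N (A - thresholded a b) + measure ?N (A \<inter> thresholded a b)"
      by (subst std_normal.finite_measure_Union[symmetric]) (auto intro!: arg_cong[where f="measure _"])
    moreover have "measure ?N (A \<inter> thresholded a b) \<le> measure ?N (thresholded a b)"
      by (rule std_normal.finite_measure_mono) auto
    ultimately show ?thesis
      by (auto simp: measure_distr_hard_threshold_map)
  qed
  \<comment> \<open>A supremum of reals dominates its terms only when the family is bounded above;
    the term of the empty set, which is 0, then gives nonnegativity.\<close>
  then have "bdd_above ((\<lambda>A. \<bar>measure ?D A - measure ?N A\<bar>) ` sets ?D)"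
    by (intro bdd_aboveI2)
  from cSUP_upper[OF _ this, of "{}"] show "0 \<le> tv_dist ?D ?N"
    by (simp add: tv_dist_def)
  show "tv_dist ?D ?N \<le> measure ?N (thresholded a b)"
    unfolding tv_dist_def by (rule cSUP_least[OF _ le]) (auto intro: sets.empty_sets)
qed

section \<open>Limits of the thresholding event and of the law\<close>

text \<open>The arguments are the limits of \<open>b - a\<close> and \<open>b + a\<close>; infinite
  values yield half-lines, the whole line or the empty set. Strict inequalities are harmless because
  the endpoints are null.\<close>

definition limit_thresholded :: "ereal \<Rightarrow> ereal \<Rightarrow> real set" where
  "limit_thresholded r s = {u. ereal u < r \<and> ereal (- u) < s}"

lemma sets_limit_thresholded [measurable]: "limit_thresholded r s \<in> sets borel"
  unfolding limit_thresholded_def by measurable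

text \<open>Away from the null points \<open>r\<close> and \<open>- s\<close>, a strict comparison
  of \<open>u\<close> with each limit decides the comparison with all late terms.\<close>

lemma AE_eventually_thresholded:
  assumes r: "(\<lambda>n. ereal (b n - a n)) \<longlonglongrightarrow> r" and s: "(\<lambda>n. ereal (b n + a n)) \<longlonglongrightarrow> s"
  shows "AE u in std_normal_distribution.
    \<forall>\<^sub>F n in sequentially. u \<in> thresholded (a n) (b n) \<longleftrightarrow> u \<in> limit_thresholded r s"
  using AE_std_normal_neq[of r] AE_std_normal_neq[of "- s"]
proof eventually_elim
  case (elim u)
  have 1: "\<forall>\<^sub>F n in sequentially. ereal u \<le> ereal (b n - a n) \<longleftrightarrow> ereal u < r"
    using elim(1) order_tendstoD[OF r, of "ereal u"]
    by (cases "ereal u" r rule: linorder_cases; auto elim!: eventually_mono)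
  have "ereal (- u) \<noteq> s"
    using elim(2) by auto
  then have 2: "\<forall>\<^sub>F n in sequentially. ereal (- u) \<le> ereal (b n + a n) \<longleftrightarrow> ereal (- u) < s"
    using order_tendstoD[OF s, of "ereal (- u)"]
    by (cases "ereal (- u)" s rule: linorder_cases; auto elim!: eventually_mono)
  from 1 2 show ?case
    by eventually_elim (auto simp: thresholded_def limit_thresholded_def abs_le_iff)
qed

lemma
  assumes r: "(\<lambda>n. ereal (b n - a n)) \<longlonglongrightarrow> r" and s: "(\<lambda>n. ereal (b n + a n)) \<longlonglongrightarrow> s"
  shows tendsto_measure_thresholded:
      "(\<lambda>n. measure std_normal_distribution (thresholded (a n) (b n)))
        \<longlonglongrightarrow> measure std_normal_distribution (limit_thresholded r s)"
    and tendsto_measure_Diff_thresholded: "C \<in> sets borel \<Longrightarrow>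
      (\<lambda>n. measure std_normal_distribution (C - thresholded (a n) (b n)))
        \<longlonglongrightarrow> measure std_normal_distribution (C - limit_thresholded r s)"
  using AE_eventually_thresholded[OF assms]
  by (auto intro!: std_normal.tendsto_measure_AE_eventually elim!: eventually_mono)

lemma pointmass_cdf_eq: "pointmass_cdf p x = of_bool (p \<le> ereal x)"
  by (simp add: pointmass_cdf_def measure_return indicator_def)

text \<open>The excluded point is the only one at which the truth value of
  \<open>- a n \<le> x\<close> may fail to settle.\<close>

lemma tendsto_cdf_hard_threshold_map:
  assumes r: "(\<lambda>n. ereal (b n - a n)) \<longlonglongrightarrow> r" and s: "(\<lambda>n. ereal (b n + a n)) \<longlonglongrightarrow> s"
    and \<nu>: "(\<lambda>n. ereal (a n)) \<longlonglongrightarrow> \<nu>" and x: "ereal x \<noteq> - \<nu>"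
  shows "(\<lambda>n. cdf (distr std_normal_distribution borel (hard_threshold_map (a n) (b n))) x) \<longlonglongrightarrow>
    measure std_normal_distribution ({..x} - limit_thresholded r s) +
    measure std_normal_distribution (limit_thresholded r s) * pointmass_cdf (- \<nu>) x"
proof -
  have "(\<lambda>n. ereal (- a n)) \<longlonglongrightarrow> - \<nu>"
    using \<nu> by (simp flip: uminus_ereal.simps)
  from order_tendstoD[OF this, of "ereal x"] x
  have "\<forall>\<^sub>F n in sequentially. of_bool (- a n \<in> {..x}) = pointmass_cdf (- \<nu>) x"
    unfolding pointmass_cdf_eq
    by (cases "ereal x" "- \<nu>" rule: linorder_cases; auto elim!: eventually_mono)
  then have "(\<lambda>n. of_bool (- a n \<in> {..x})) \<longlonglongrightarrow> pointmass_cdf (- \<nu>) x"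
    by (rule tendsto_eventually)
  then show ?thesis
    unfolding cdf_def measure_distr_hard_threshold_map[OF borel_closed[OF closed_atMost]]
    by (intro tendsto_intros tendsto_measure_thresholded tendsto_measure_Diff_thresholded r s) auto
qed

text \<open>A limit of minus infinity makes the limiting event empty, so the bound by the mass of
  the event tends to 0.\<close>

lemma tendsto_tv_dist_hard_threshold_map:
  assumes r: "(\<lambda>n. ereal (b n - a n)) \<longlonglongrightarrow> r" and s: "(\<lambda>n. ereal (b n + a n)) \<longlonglongrightarrow> s"
    and "r = - \<infinity> \<or> s = - \<infinity>"
  shows "(\<lambda>n. tv_dist (distr std_normal_distribution borel (hard_threshold_map (a n) (b n)))
    std_normal_distribution) \<longlonglongrightarrow> 0"
proof (rule tendsto_sandwich[OF _ _ tendsto_const])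
  have "limit_thresholded r s = {}"
    using assms(3) by (auto simp: limit_thresholded_def)
  with tendsto_measure_thresholded[OF r s]
  show "(\<lambda>n. measure std_normal_distribution (thresholded (a n) (b n))) \<longlonglongrightarrow> 0"
    by simp
qed (simp_all add: tv_dist_hard_threshold_map)

section \<open>Symmetry of the standard normal law and values of \<open>Phi\<close>\<close>

lemma distr_uminus_std_normal: "distr std_normal_distribution borel uminus = std_normal_distribution"
proof -
  \<comment> \<open>The identity serves as a standard normal variable on its own distribution; the
    affine map with slope -1 preserves its density.\<close>
  have "distributed std_normal_distribution lborel (\<lambda>x. x) std_normal_density"
    by (auto simp: distributed_def distr_id2)
  from std_normal.normal_density_affine[OF this, of "-1" 0]
  have "distributed std_normal_distribution lborel uminus std_normal_density"
    by simp
  from distributed_distr_eq_density[OF this] show ?thesis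
    using distr_cong[OF refl sets_lborel refl] by metis
qed

lemma measure_std_normal_less: "measure std_normal_distribution {u. ereal u < r} = Phi r"
proof (cases r)
  case (real c)
  have "measure std_normal_distribution {u. ereal u < r} = measure std_normal_distribution {..c}"
    using AE_std_normal_neq[of r] 
    by (intro std_normal.finite_measure_eq_AE) (auto simp: real elim!: eventually_mono)
  then show ?thesis
    by (simp add: Phi_def cdf_def real)
qed (simp_all add: Phi_def std_normal.prob_space[simplified])

lemma measure_std_normal_uminus_less: "measure std_normal_distribution {u. ereal (- u) < r} = Phi r"
proof -
  have "measure std_normal_distribution {u. ereal (- u) < r} =
      measure (distr std_normal_distribution borel uminus) {u. ereal u < r}"
    by (subst measure_distr) (auto simp: vimage_def)
  then show ?thesis
    by (simp add: distr_uminus_std_normal measure_std_normal_less)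
qed

lemma measure_std_normal_scaled_less:
  assumes "\<bar>z\<bar> = 1"
  shows "measure std_normal_distribution {u. ereal (z * u) < r} = Phi r"
proof -
  have "z = 1 \<or> z = -1" using assms by auto
  then show ?thesis
    using measure_std_normal_less measure_std_normal_uminus_less by auto
qed

lemma AE_std_normal_scaled_neq:
  assumes "\<bar>z\<bar> = 1"
  shows "AE u in std_normal_distribution. ereal (z * u) \<noteq> r"
proof -
  have "z = 1 \<or> z = -1" using assms by auto
  moreover have "AE u in std_normal_distribution. ereal (- u) \<noteq> r"
    using AE_std_normal_neq[of "- r"] by eventually_elim auto
  ultimately show ?thesis
    using AE_std_normal_neq[of r] by auto
qed

text \<open>The two sets differ at most where \<open>z * u\<close> equals \<open>r\<close>, which is
  a null set.\<close>

lemma measure_std_normal_scaled_greater: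
  assumes "\<bar>z\<bar> = 1" and [measurable]: "C \<in> sets borel"
  shows "measure std_normal_distribution (C \<inter> {u. ereal (z * u) > r}) =
    measure std_normal_distribution (C - {u. ereal (z * u) < r})"
  using AE_std_normal_scaled_neq[OF assms(1), of r]
  by (intro std_normal.finite_measure_eq_AE) (auto elim!: eventually_mono)

text \<open>Otherwise positivity of the density would place Lebesgue-almost every real below
  \<open>r\<close>, although a unit interval lies above it.\<close>

lemma Phi_less_1:
  assumes "r \<noteq> \<infinity>"
  shows "Phi r < 1"
proof (rule ccontr)
  assume "\<not> Phi r < 1"
  then have "measure std_normal_distribution {u. ereal u < r} = 1"
    using std_normal.prob_le_1[of "{u. ereal u < r}"] measure_std_normal_less[of r] by auto
  then have "AE u in std_normal_distribution. u \<in> {u. ereal u < r}"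
    by (intro std_normal.AE_prob_1)
  then have "AE u in lborel. ereal u < r"
    by (subst (asm) AE_density) (auto elim!: eventually_mono simp: normal_density_pos)
  moreover obtain c where "r \<le> ereal c"
    using assms by (cases r) auto
  ultimately have "AE u in lborel. u \<notin> {c..c+1}"
    by (auto elim!: eventually_mono dest: order.strict_trans2)
  then have "emeasure lborel {c..c+1} = 0"
    by (subst (asm) AE_iff_measurable[of "{c..c+1}"]) auto
  then show False by simp
qed

section \<open>The limit distribution and its absolutely continuous component\<close>

lemma limit_cdf_eq:
  "limit_cdf z r x = Phi r * of_bool (z = 1) +
    measure std_normal_distribution ({..x} \<inter> {u. ereal (z * u) > r})"
proof -
  have "(LBINT u:{..x}. std_normal_density u * of_bool (ereal (z * u) > r)) =
      (LBINT u. std_normal_density u *\<^sub>R indicator ({..x} \<inter> {u. ereal (z * u) > r}) u)"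
    unfolding set_lebesgue_integral_def by (intro Bochner_Integration.integral_cong) (auto simp: indicator_def)
  also have "\<dots> = (\<integral>u. indicator ({..x} \<inter> {u. ereal (z * u) > r}) u \<partial>std_normal_distribution)"
    by (subst integral_density) auto
  finally show ?thesis
    by (simp add: limit_cdf_def)
qed

lemma emeasure_ac_part:
  assumes "\<bar>z\<bar> = 1" "r \<noteq> \<infinity>" and [measurable]: "A \<in> sets borel"
  shows "emeasure (ac_part z r) A =
    ennreal (measure std_normal_distribution (A \<inter> {u. ereal (z * u) > r}) / (1 - Phi r))"
proof -
  have "emeasure (ac_part z r) A = (\<integral>\<^sup>+u. ennreal (1 / (1 - Phi r)) *
      (ennreal (std_normal_density u) * indicator (A \<inter> {u. ereal (z * u) > r}) u) \<partial>lborel)"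
    unfolding ac_part_def using Phi_less_1[OF assms(2)]
    by (subst emeasure_density)
       (auto intro!: nn_integral_cong simp: indicator_def simp flip: ennreal_mult)
  also have "\<dots> = ennreal (1 / (1 - Phi r)) *
      emeasure std_normal_distribution (A \<inter> {u. ereal (z * u) > r})"
    by (subst nn_integral_cmult) (auto simp: emeasure_density)
  also have "\<dots> = ennreal (measure std_normal_distribution (A \<inter> {u. ereal (z * u) > r}) / (1 - Phi r))"
    using Phi_less_1[OF assms(2)]
    by (simp add: std_normal.emeasure_eq_measure flip: ennreal_mult)
  finally show ?thesis .
qed

text \<open>Up to a null set, the support condition is the complement of an event of mass
  \<open>Phi r\<close>, so the factor in the density normalises it.\<close>

lemma prob_space_ac_part:
  assumes "\<bar>z\<bar> = 1" "r \<noteq> \<infinity>"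
  shows "prob_space (ac_part z r)"
proof
  have "measure std_normal_distribution (UNIV \<inter> {u. ereal (z * u) > r}) = 1 - Phi r"
    using std_normal.prob_compl[of "{u. ereal (z * u) < r}"]
    by (subst measure_std_normal_scaled_greater[OF assms(1)])
       (simp_all add: measure_std_normal_scaled_less[OF assms(1)])
  with emeasure_ac_part[OF assms, of UNIV] Phi_less_1[OF assms(2)]
  show "emeasure (ac_part z r) (space (ac_part z r)) = 1"
    by (simp add: ac_part_def)
qed

lemma measure_ac_part:
  assumes "\<bar>z\<bar> = 1" "r \<noteq> \<infinity>" "A \<in> sets borel"
  shows "(1 - Phi r) * measure (ac_part z r) A =
    measure std_normal_distribution (A \<inter> {u. ereal (z * u) > r})"
  using emeasure_ac_part[OF assms] Phi_less_1[OF assms(2)] by (simp add: measure_def)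

text \<open>Here \<open>Phi\<close> is 0 and the indicator is constantly 1. Hence convergence to the
  standard normal law in total variation also settles the boundary regime with
  \<open>r = - \<infinity>\<close>.\<close>

lemma ac_part_MInfty: "ac_part z (- \<infinity>) = std_normal_distribution"
  by (simp add: ac_part_def Phi_def)

section \<open>Limits of the scaled parameters\<close>

text \<open>Eventually \<open>a\<close> is the ratio times \<open>b\<close>, and the product of
  limits is determinate because the ratio does not tend to 0.\<close>

lemma tendsto_ratio_imp_tendsto_Infty:
  fixes a b :: "nat \<Rightarrow> real"
  assumes b: "filterlim b at_top sequentially"
    and \<zeta>: "(\<lambda>n. ereal (a n / b n)) \<longlonglongrightarrow> \<zeta>" "\<zeta> \<noteq> 0"
  shows "(\<lambda>n. ereal (a n)) \<longlonglongrightarrow> sgn \<zeta> * \<infinity>"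
proof -
  have "(\<lambda>n. ereal (b n)) \<longlonglongrightarrow> \<infinity>"
    using b by (simp add: tendsto_PInfty_eq_at_top)
  with \<zeta> have lim: "(\<lambda>n. ereal (a n / b n) * ereal (b n)) \<longlonglongrightarrow> \<zeta> * \<infinity>"
    by (intro tendsto_mult_ereal) auto
  have "\<forall>\<^sub>F n in sequentially. ereal (a n / b n) * ereal (b n) = ereal (a n)"
    using b[unfolded filterlim_at_top_dense, rule_format, of 0] by eventually_elim auto
  with lim have "(\<lambda>n. ereal (a n)) \<longlonglongrightarrow> \<zeta> * \<infinity>"
    by (rule Lim_transform_eventually)
  also have "\<zeta> * \<infinity> = sgn \<zeta> * \<infinity>"
    using \<zeta>(2) by (cases \<zeta>) (auto simp: sgn_if)
  finally show ?thesis .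
qed

text \<open>Divided by \<open>b\<close>, the two bounds tend to \<open>1 - \<zeta>\<close> and
  \<open>1 + \<zeta>\<close>. The preceding lemma applies whenever this limit is nonzero.\<close>

lemma
  fixes a b :: "nat \<Rightarrow> real"
  assumes b: "filterlim b at_top sequentially"
    and \<zeta>: "(\<lambda>n. ereal (a n / b n)) \<longlonglongrightarrow> \<zeta>"
  shows tendsto_diff_threshold: "\<zeta> \<noteq> 1 \<Longrightarrow> (\<lambda>n. ereal (b n - a n)) \<longlonglongrightarrow> sgn (1 - \<zeta>) * \<infinity>"
    and tendsto_add_threshold: "\<zeta> \<noteq> - 1 \<Longrightarrow> (\<lambda>n. ereal (b n + a n)) \<longlonglongrightarrow> sgn (1 + \<zeta>) * \<infinity>"
proof -
  have pos: "\<forall>\<^sub>F n in sequentially. 0 < b n"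
    using b[unfolded filterlim_at_top_dense] by blast
  have "(\<lambda>n. 1 - ereal (a n / b n)) \<longlonglongrightarrow> 1 - \<zeta>"
    by (intro tendsto_diff_ereal_general tendsto_const \<zeta>) auto
  moreover have "\<forall>\<^sub>F n in sequentially. 1 - ereal (a n / b n) = ereal ((b n - a n) / b n)"
    using pos by eventually_elim (auto simp: one_ereal_def diff_divide_distrib)
  ultimately have "(\<lambda>n. ereal ((b n - a n) / b n)) \<longlonglongrightarrow> 1 - \<zeta>"
    by (rule Lim_transform_eventually)
  moreover have "1 - \<zeta> \<noteq> 0" if "\<zeta> \<noteq> 1"
    using that by (cases \<zeta>) (auto simp: one_ereal_def zero_ereal_def)
  ultimately show "(\<lambda>n. ereal (b n - a n)) \<longlonglongrightarrow> sgn (1 - \<zeta>) * \<infinity>" if "\<zeta> \<noteq> 1"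
    using tendsto_ratio_imp_tendsto_Infty[OF b, of "\<lambda>n. b n - a n" "1 - \<zeta>"] that by blast
  have "(\<lambda>n. 1 + ereal (a n / b n)) \<longlonglongrightarrow> 1 + \<zeta>"
    by (intro tendsto_add_ereal_general tendsto_const \<zeta>) auto
  moreover have "\<forall>\<^sub>F n in sequentially. 1 + ereal (a n / b n) = ereal ((b n + a n) / b n)"
    using pos by eventually_elim (auto simp: one_ereal_def add_divide_distrib)
  ultimately have "(\<lambda>n. ereal ((b n + a n) / b n)) \<longlonglongrightarrow> 1 + \<zeta>"
    by (rule Lim_transform_eventually)
  moreover have "1 + \<zeta> \<noteq> 0" if "\<zeta> \<noteq> - 1"
    using that by (cases \<zeta>) (auto simp: one_ereal_def zero_ereal_def)
  ultimately show "(\<lambda>n. ereal (b n + a n)) \<longlonglongrightarrow> sgn (1 + \<zeta>) * \<infinity>" if "\<zeta> \<noteq> - 1"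
    using tendsto_ratio_imp_tendsto_Infty[OF b, of "\<lambda>n. b n + a n" "1 + \<zeta>"] that by blast
qed

section \<open>The three regimes of the limiting ratio\<close>

theorem theorem9:
  fixes P :: "nat \<Rightarrow> real \<Rightarrow> 'a measure"
    and y :: "nat \<Rightarrow> 'a \<Rightarrow> real"
    and \<eta> \<theta> :: "nat \<Rightarrow> real"
    and \<zeta> :: ereal
  assumes prob: "\<And>n \<tau>. n \<ge> 1 \<Longrightarrow> prob_space (P n \<tau>)"
    and indep: "\<And>n \<tau>. n \<ge> 1 \<Longrightarrow> prob_space.indep_vars (P n \<tau>) (\<lambda>_. borel) y {1..n}"
    and normal: "\<And>n \<tau> t. n \<ge> 1 \<Longrightarrow> t \<in> {1..n} \<Longrightarrow>
                   distributed (P n \<tau>) lborel (y t) (\<lambda>x. ennreal (normal_density \<tau> 1 x))"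
    and \<eta>_pos: "\<And>n. n \<ge> 1 \<Longrightarrow> \<eta> n > 0"
    and \<eta>_zero: "\<eta> \<longlonglongrightarrow> 0"
    and \<eta>_slow: "filterlim (\<lambda>n. sqrt (real n) * \<eta> n) at_top sequentially"
    and \<zeta>_lim: "(\<lambda>n. ereal (\<theta> n / \<eta> n)) \<longlonglongrightarrow> \<zeta>"
  shows
    "(\<zeta> \<noteq> 0 \<longrightarrow> (\<lambda>n. ereal (sqrt (real n) * \<theta> n)) \<longlonglongrightarrow> sgn \<zeta> * \<infinity>) \<and>
     (\<forall>\<nu>::ereal. (\<lambda>n. ereal (sqrt (real n) * \<theta> n)) \<longlonglongrightarrow> \<nu> \<longrightarrow>
        (\<zeta> \<noteq> 0 \<longrightarrow> \<nu> = sgn \<zeta> * \<infinity>) \<and>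
        (\<bar>\<zeta>\<bar> < 1 \<longrightarrow>
           (\<forall>v::real. \<nu> = ereal v \<longrightarrow>
              weak_conv_m (\<lambda>n. F_H P y \<eta> n (\<theta> n)) (return borel (- v))) \<and>
           (- \<nu> = \<infinity> \<longrightarrow> (\<forall>x. (\<lambda>n. cdf (F_H P y \<eta> n (\<theta> n)) x) \<longlonglongrightarrow> 0)) \<and>
           (- \<nu> = - \<infinity> \<longrightarrow> (\<forall>x. (\<lambda>n. cdf (F_H P y \<eta> n (\<theta> n)) x) \<longlonglongrightarrow> 1))) \<and>
        (\<forall>z::real. \<zeta> = ereal z \<and> \<bar>z\<bar> = 1 \<longrightarrow>
           (\<forall>r::ereal. (\<lambda>n. ereal (sqrt (real n) * (\<eta> n - z * \<theta> n))) \<longlonglongrightarrow> r \<longrightarrow>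
              (\<forall>x. (\<lambda>n. cdf (F_H P y \<eta> n (\<theta> n)) x) \<longlonglongrightarrow> limit_cdf z r x) \<and>
              - \<nu> = sgn (- \<zeta>) * \<infinity> \<and>
              (r = \<infinity> \<longrightarrow> (\<forall>x. limit_cdf z r x = pointmass_cdf (- \<nu>) x)) \<and>
              (r \<noteq> \<infinity> \<longrightarrow>
                 0 \<le> Phi r \<and> Phi r < 1 \<and>
                 prob_space (ac_part z r) \<and>
                 (\<forall>x. limit_cdf z r x =
                    Phi r * pointmass_cdf (- \<nu>) x + (1 - Phi r) * cdf (ac_part z r) x)) \<and>
              (r = - \<infinity> \<longrightarrow>
                 1 - Phi r = 1 \<and>
                 (\<lambda>n. tv_dist (F_H P y \<eta> n (\<theta> n)) (ac_part z r)) \<longlonglongrightarrow> 0))) \<and>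
        (1 < \<bar>\<zeta>\<bar> \<longrightarrow>
           weak_conv_m (\<lambda>n. F_H P y \<eta> n (\<theta> n)) std_normal_distribution \<and>
           (\<lambda>n. tv_dist (F_H P y \<eta> n (\<theta> n)) std_normal_distribution) \<longlonglongrightarrow> 0))"
proof -
  define a where "a n = sqrt (real n) * \<theta> n" for n
  define b where "b n = sqrt (real n) * \<eta> n" for n
  define F where "F n = F_H P y \<eta> n (\<theta> n)" for n
  define D where "D n = distr std_normal_distribution borel (hard_threshold_map (a n) (b n))" for n
  \<comment> \<open>The hypotheses say nothing about \<open>n = 0\<close>, so the laws are
    identified only eventually, which suffices for limits.\<close>
  have F_eq_D: "\<forall>\<^sub>F n in sequentially. F n = D n"
    using eventually_ge_at_top[of 1] unfolding F_def D_def a_def b_def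
    by eventually_elim (intro F_H_eq_distr_hard_threshold_map prob indep normal)
  have b_lim: "filterlim b at_top sequentially"
    using \<eta>_slow unfolding b_def .
  have "\<forall>\<^sub>F n in sequentially. ereal (\<theta> n / \<eta> n) = ereal (a n / b n)"
    using eventually_ge_at_top[of 1] by eventually_elim (auto simp: a_def b_def)
  then have ratio_lim: "(\<lambda>n. ereal (a n / b n)) \<longlonglongrightarrow> \<zeta>"
    by (rule Lim_transform_eventually[OF \<zeta>_lim])
  have a_lim: "(\<lambda>n. ereal (a n)) \<longlonglongrightarrow> sgn \<zeta> * \<infinity>" if "\<zeta> \<noteq> 0"
    by (rule tendsto_ratio_imp_tendsto_Infty[OF b_lim ratio_lim that])
  note diff_lim = tendsto_diff_threshold[OF b_lim ratio_lim]
  note add_lim = tendsto_add_threshold[OF b_lim ratio_lim]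
  have tv_lim: "(\<lambda>n. tv_dist (F n) std_normal_distribution) \<longlonglongrightarrow> 0"
    if "(\<lambda>n. ereal (b n - a n)) \<longlonglongrightarrow> r" "(\<lambda>n. ereal (b n + a n)) \<longlonglongrightarrow> s" "r = - \<infinity> \<or> s = - \<infinity>" for r s
  proof -
    have "(\<lambda>n. tv_dist (D n) std_normal_distribution) \<longlonglongrightarrow> 0"
      unfolding D_def by (rule tendsto_tv_dist_hard_threshold_map[OF that])
    moreover have "\<forall>\<^sub>F n in sequentially.
        tv_dist (D n) std_normal_distribution = tv_dist (F n) std_normal_distribution"
      using F_eq_D by eventually_elim simp
    ultimately show ?thesis
      by (rule Lim_transform_eventually)
  qed
  have limits: "(\<zeta> \<noteq> 0 \<longrightarrow> \<nu> = sgn \<zeta> * \<infinity>) \<and>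
        (\<bar>\<zeta>\<bar> < 1 \<longrightarrow>
           (\<forall>v::real. \<nu> = ereal v \<longrightarrow> weak_conv_m F (return borel (- v))) \<and>
           (- \<nu> = \<infinity> \<longrightarrow> (\<forall>x. (\<lambda>n. cdf (F n) x) \<longlonglongrightarrow> 0)) \<and>
           (- \<nu> = - \<infinity> \<longrightarrow> (\<forall>x. (\<lambda>n. cdf (F n) x) \<longlonglongrightarrow> 1))) \<and>
        (\<forall>z::real. \<zeta> = ereal z \<and> \<bar>z\<bar> = 1 \<longrightarrow>
           (\<forall>r::ereal. (\<lambda>n. ereal (b n - z * a n)) \<longlonglongrightarrow> r \<longrightarrow>
              (\<forall>x. (\<lambda>n. cdf (F n) x) \<longlonglongrightarrow> limit_cdf z r x) \<and>
              - \<nu> = sgn (- \<zeta>) * \<infinity> \<and>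
              (r = \<infinity> \<longrightarrow> (\<forall>x. limit_cdf z r x = pointmass_cdf (- \<nu>) x)) \<and>
              (r \<noteq> \<infinity> \<longrightarrow>
                 0 \<le> Phi r \<and> Phi r < 1 \<and>
                 prob_space (ac_part z r) \<and>
                 (\<forall>x. limit_cdf z r x =
                    Phi r * pointmass_cdf (- \<nu>) x + (1 - Phi r) * cdf (ac_part z r) x)) \<and>
              (r = - \<infinity> \<longrightarrow>
                 1 - Phi r = 1 \<and> (\<lambda>n. tv_dist (F n) (ac_part z r)) \<longlonglongrightarrow> 0))) \<and>
        (1 < \<bar>\<zeta>\<bar> \<longrightarrow>
           weak_conv_m F std_normal_distribution \<and>
           (\<lambda>n. tv_dist (F n) std_normal_distribution) \<longlonglongrightarrow> 0)"
    if \<nu>: "(\<lambda>n. ereal (a n)) \<longlonglongrightarrow> \<nu>" for \<nu>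
  proof (intro conjI impI)
    show \<nu>_eq: "\<nu> = sgn \<zeta> * \<infinity>" if "\<zeta> \<noteq> 0"
      using LIMSEQ_unique[OF \<nu> a_lim[OF that]] .
    have cdf_lim: "(\<lambda>n. cdf (F n) x) \<longlonglongrightarrow>
        measure std_normal_distribution ({..x} - limit_thresholded r s) +
        measure std_normal_distribution (limit_thresholded r s) * pointmass_cdf (- \<nu>) x"
      if "(\<lambda>n. ereal (b n - a n)) \<longlonglongrightarrow> r" "(\<lambda>n. ereal (b n + a n)) \<longlonglongrightarrow> s" "ereal x \<noteq> - \<nu>" for r s x
    proof -
      have "(\<lambda>n. cdf (D n) x) \<longlonglongrightarrow>
          measure std_normal_distribution ({..x} - limit_thresholded r s) +
          measure std_normal_distribution (limit_thresholded r s) * pointmass_cdf (- \<nu>) x"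
        unfolding D_def by (rule tendsto_cdf_hard_threshold_map[OF that(1,2) \<nu> that(3)])
      moreover have "\<forall>\<^sub>F n in sequentially. cdf (D n) x = cdf (F n) x"
        using F_eq_D by eventually_elim simp
      ultimately show ?thesis
        by (rule Lim_transform_eventually)
    qed
    {
      assume small: "\<bar>\<zeta>\<bar> < 1"
      \<comment> \<open>Both bounds tend to infinity, so the limiting event is the whole line and
        only the pointmass term survives.\<close>
      have "sgn (1 - \<zeta>) * \<infinity> = \<infinity>" "sgn (1 + \<zeta>) * \<infinity> = \<infinity>" "\<zeta> \<noteq> 1" "\<zeta> \<noteq> - 1"
        using small by (cases \<zeta>; auto simp: one_ereal_def)+
      with diff_lim add_lim
      have "(\<lambda>n. ereal (b n - a n)) \<longlonglongrightarrow> \<infinity>" "(\<lambda>n. ereal (b n + a n)) \<longlonglongrightarrow> \<infinity>"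
        by auto
      from cdf_lim[OF this]
      have lim: "(\<lambda>n. cdf (F n) x) \<longlonglongrightarrow> of_bool (- \<nu> \<le> ereal x)" if "ereal x \<noteq> - \<nu>" for x
        using that std_normal.prob_space by (simp add: limit_thresholded_def pointmass_cdf_eq)
      show "\<forall>v::real. \<nu> = ereal v \<longrightarrow> weak_conv_m F (return borel (- v))"
        unfolding weak_conv_m_def weak_conv_def
      proof (intro allI impI)
        fix v x :: real
        assume v: "\<nu> = ereal v" and cont: "isCont (cdf (return borel (- v))) x"
        interpret R: prob_space "return borel (- v)"
          by (rule prob_space_return) simp
        interpret R: real_distribution "return borel (- v)"
          by unfold_locales auto
        \<comment> \<open>The cdf of the pointmass jumps at \<open>- v\<close>, so continuity rules
          out exactly the point not covered by \<open>lim\<close>.\<close>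
        have "x \<noteq> - v"
          using cont R.isCont_cdf[of x] by (auto simp: measure_return)
        then show "(\<lambda>n. cdf (F n) x) \<longlonglongrightarrow> cdf (return borel (- v)) x"
          using lim[of x] by (simp add: v cdf_def measure_return indicator_def)
      qed
      show "\<forall>x. (\<lambda>n. cdf (F n) x) \<longlonglongrightarrow> 0" if "- \<nu> = \<infinity>"
        using lim that by simp
      show "\<forall>x. (\<lambda>n. cdf (F n) x) \<longlonglongrightarrow> 1" if "- \<nu> = - \<infinity>"
        using lim that by (simp del: ereal_uminus_eq_iff)
    }
    {
      assume large: "1 < \<bar>\<zeta>\<bar>"
      define r s where "r = sgn (1 - \<zeta>) * \<infinity>" and "s = sgn (1 + \<zeta>) * \<infinity>"
      \<comment> \<open>A ratio limit above 1 drives \<open>b - a\<close> to minus infinity, one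
        below -1 drives \<open>b + a\<close> there.\<close>
      have neq: "\<zeta> \<noteq> 1" "\<zeta> \<noteq> - 1" "\<zeta> \<noteq> 0" and rs: "r = - \<infinity> \<or> s = - \<infinity>"
        using large unfolding r_def s_def by (cases \<zeta>; auto simp: one_ereal_def abs_if sgn_if split: if_splits)+
      note r = diff_lim[OF neq(1), folded r_def] and s = add_lim[OF neq(2), folded s_def]
      show "(\<lambda>n. tv_dist (F n) std_normal_distribution) \<longlonglongrightarrow> 0"
        by (rule tv_lim[OF r s rs])
      have "limit_thresholded r s = {}"
        using rs by (auto simp: limit_thresholded_def)
      \<comment> \<open>As \<open>\<nu>\<close> is infinite in this regime, no real argument is
        exceptional.\<close>
      moreover have "ereal x \<noteq> - \<nu>" for x
        using \<nu>_eq neq(3) by (cases \<zeta>) (auto simp: sgn_if)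
      ultimately show "weak_conv_m F std_normal_distribution"
        using cdf_lim[OF r s] by (simp add: weak_conv_m_def weak_conv_def cdf_def)
    }
    show "\<forall>z::real. \<zeta> = ereal z \<and> \<bar>z\<bar> = 1 \<longrightarrow>
           (\<forall>r::ereal. (\<lambda>n. ereal (b n - z * a n)) \<longlonglongrightarrow> r \<longrightarrow>
              (\<forall>x. (\<lambda>n. cdf (F n) x) \<longlonglongrightarrow> limit_cdf z r x) \<and>
              - \<nu> = sgn (- \<zeta>) * \<infinity> \<and>
              (r = \<infinity> \<longrightarrow> (\<forall>x. limit_cdf z r x = pointmass_cdf (- \<nu>) x)) \<and>
              (r \<noteq> \<infinity> \<longrightarrow>
                 0 \<le> Phi r \<and> Phi r < 1 \<and>
                 prob_space (ac_part z r) \<and>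
                 (\<forall>x. limit_cdf z r x =
                    Phi r * pointmass_cdf (- \<nu>) x + (1 - Phi r) * cdf (ac_part z r) x)) \<and>
              (r = - \<infinity> \<longrightarrow>
                 1 - Phi r = 1 \<and> (\<lambda>n. tv_dist (F n) (ac_part z r)) \<longlonglongrightarrow> 0))"
    proof (rule allI, rule impI, elim conjE, rule allI, rule impI)
      fix z :: real and r :: ereal
      assume \<zeta>: "\<zeta> = ereal z" and z: "\<bar>z\<bar> = 1" and r: "(\<lambda>n. ereal (b n - z * a n)) \<longlonglongrightarrow> r"
      have z_cases: "z = 1 \<or> z = - 1"
        using z by auto
      have \<nu>_eq: "- \<nu> = sgn (- \<zeta>) * \<infinity>"
        using z_cases \<zeta> \<nu>_eq by auto
      \<comment> \<open>For \<open>z = 1\<close> the escaping mass sits at minus infinity and counts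
        below every real; for \<open>z = - 1\<close> it sits at plus infinity and never counts. This
        explains the indicator in \<open>limit_cdf\<close>.\<close>
      have pm: "pointmass_cdf (- \<nu>) x = of_bool (z = 1)" for x
        using z_cases unfolding \<nu>_eq pointmass_cdf_eq \<zeta> by auto
      \<comment> \<open>The hypothesis on \<open>r\<close> controls one of the two bounds,
        \<open>b - a\<close> or \<open>b + a\<close> according to the sign of \<open>z\<close>; the
        other tends to infinity and imposes no restriction in the limit.\<close>
      obtain r' s' where r': "(\<lambda>n. ereal (b n - a n)) \<longlonglongrightarrow> r'" and s': "(\<lambda>n. ereal (b n + a n)) \<longlonglongrightarrow> s'"
        and S: "limit_thresholded r' s' = {u. ereal (z * u) < r}"
        and MInf: "r = - \<infinity> \<Longrightarrow> r' = - \<infinity> \<or> s' = - \<infinity>"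
      proof (cases "z = 1")
        case True
        then have "(\<lambda>n. ereal (b n + a n)) \<longlonglongrightarrow> \<infinity>"
          using add_lim by (auto simp: \<zeta> one_ereal_def)
        with True r show thesis
          by (intro that[of r "\<infinity>"]) (auto simp: limit_thresholded_def)
      next
        case False
        then have "z = - 1"
          using z_cases by simp
        moreover from this have "(\<lambda>n. ereal (b n - a n)) \<longlonglongrightarrow> \<infinity>"
          using diff_lim by (auto simp: \<zeta> one_ereal_def)
        ultimately show thesis
          using r by (intro that[of "\<infinity>" r]) (auto simp: limit_thresholded_def)
      qed
      have limit: "limit_cdf z r x = measure std_normal_distribution ({..x} - limit_thresholded r' s') +
          measure std_normal_distribution (limit_thresholded r' s') * pointmass_cdf (- \<nu>) x" for x
        unfolding limit_cdf_eq S measure_std_normal_scaled_less[OF z] pm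
        by (subst measure_std_normal_scaled_greater[OF z]) auto
      have "ereal x \<noteq> - \<nu>" for x
        using z_cases unfolding \<nu>_eq \<zeta> by auto
      with cdf_lim[OF r' s'] have "\<forall>x. (\<lambda>n. cdf (F n) x) \<longlonglongrightarrow> limit_cdf z r x"
        unfolding limit by blast
      moreover have "limit_cdf z r x = pointmass_cdf (- \<nu>) x" if "r = \<infinity>" for x
        by (simp add: limit_cdf_eq pm that Phi_def)
      moreover have "0 \<le> Phi r"
        unfolding measure_std_normal_less[symmetric] by simp
      moreover have "limit_cdf z r x = Phi r * pointmass_cdf (- \<nu>) x + (1 - Phi r) * cdf (ac_part z r) x"
        if "r \<noteq> \<infinity>" for x
        by (simp add: limit_cdf_eq pm cdf_def measure_ac_part[OF z that])
      moreover have "1 - Phi r = 1 \<and> (\<lambda>n. tv_dist (F n) (ac_part z r)) \<longlonglongrightarrow> 0" if "r = - \<infinity>"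
        using tv_lim[OF r' s' MInf[OF that]] by (simp add: that ac_part_MInfty) (simp add: Phi_def)
      ultimately show "(\<forall>x. (\<lambda>n. cdf (F n) x) \<longlonglongrightarrow> limit_cdf z r x) \<and>
              - \<nu> = sgn (- \<zeta>) * \<infinity> \<and>
              (r = \<infinity> \<longrightarrow> (\<forall>x. limit_cdf z r x = pointmass_cdf (- \<nu>) x)) \<and>
              (r \<noteq> \<infinity> \<longrightarrow>
                 0 \<le> Phi r \<and> Phi r < 1 \<and>
                 prob_space (ac_part z r) \<and>
                 (\<forall>x. limit_cdf z r x =
                    Phi r * pointmass_cdf (- \<nu>) x + (1 - Phi r) * cdf (ac_part z r) x)) \<and>
              (r = - \<infinity> \<longrightarrow>
                 1 - Phi r = 1 \<and> (\<lambda>n. tv_dist (F n) (ac_part z r)) \<longlonglongrightarrow> 0)"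
        using \<nu>_eq Phi_less_1[of r] prob_space_ac_part[OF z, of r] by simp
    qed
  qed
  \<comment> \<open>This matches the boundary hypothesis of the statement with the form used in
    \<open>limits\<close>.\<close>
  have scale: "sqrt (real n) * (\<eta> n - z * \<theta> n) = b n - z * a n" for n z
    by (simp add: a_def b_def algebra_simps)
  show ?thesis
    unfolding scale F_def[symmetric] a_def[symmetric]
    by (rule conjI, rule impI, erule a_lim, rule allI, rule impI, erule limits)
qed

end
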